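(* Consider the standard model of floating point arithmetic satisfying the IEEE 754 standard, with set of floating point numbers $\mathbb{F}$. Let $$A=PTP^{T},\qquad v=\widetilde{\beta}_{1}Pe_{1},$$ where $P\in\mathbb{F}^{n\times n}$ is a signed permutation matrix, $e_1$ is the first column of the identity matrix, $\widetilde\beta_1\in\mathbb{F}$, and $T\in\mathbb{F}^{n\times n}$ is symmetric tridiagonal of the form $$T=\begin{bmatrix}\widetilde{\alpha}_{1} & \widetilde{\beta}_{2}\\ \widetilde{\beta}_{2} & \ddots & \ddots\\ & \ddots & \ddots & \widetilde{\beta}_{n}\\ & & \widetilde{\beta}_{n} & \widetilde{\alpha}_{n}\end{bmatrix},$$ with $\widetilde{\beta}_{j}>0$ and $\widetilde{\beta}_{j}^{2}$ within the exponent range for $j=1,\dots,n$. Then the Lanczos algorithm applied to $A$ and $v$ in floating point arithmetic computes exactly. As a consequence, $T_n=T$, where $T_n$ is the tridiagonal matrix of the computed Lanczos coefficients.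
   Context: **Floating point arithmetic.** $\mathbb{F}$ is the set of floating point numbers of an IEEE 754 binary format (e.g. binary64, binary32, binary16), with rounding to nearest. For $\alpha,\beta\in\mathbb{F}$ and a basic operation $\circ$ (addition, subtraction, multiplication, division; similarly the square root), $\mathrm{fl}(\alpha\circ\beta)$ is the floating point number nearest to the exact value; if the exact value is within the exponent range (no overflow or underflow), then $\mathrm{fl}(\alpha\circ\beta)=(\alpha\circ\beta)(1+\delta)$ with $|\delta|\le\mathbf{u}$, where $\mathbf{u}$ is the unit roundoff ($2\mathbf{u}$ is the machine epsilon). A positive real number is within the exponent range if it lies between the smallest positive normalized and the largest finite floating point number. Inner products and matrix-vector products are evaluated as floating point sums of floating point products; the Euclidean norm $\|z\|$ is evaluated as the floating point square root of the floating point sum of the floating point squares of the entries. Signed zeros are identified. **Signed permutation matrix.** A permutation matrix in which the entries $1$ are replaced by $\pm1$. **Lanczos algorithm** (input: symmetric $A$, vector $v$). Set $\beta_1=\|v\|$, $v_0=0$, $v_1=v/\beta_1$. For $i=1,2,\dots,n$: $w=Av_i-\beta_iv_{i-1}$; $\alpha_i=w^Tv_i$; $z=w-\alpha_iv_i$; $\beta_{i+1}=\|z\|$; if $\beta_{i+1}=0$ then stop; $v_{i+1}=z/\beta_{i+1}$. $T_k$ is the $k\times k$ symmetric tridiagonal matrix with diagonal $\alpha_1,\dots,\alpha_k$ and off-diagonal entries $\beta_2,\dots,\beta_k$. **Computes exactly.** The algorithm computes exactly if every vector and coefficient assigned in the lines of the algorithm ($\beta_i$, $v_i$, $w$, $\alpha_i$,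 $z$), when computed in floating point arithmetic, coincides with the corresponding quantity produced by the algorithm in exact arithmetic (no rounding errors appear in these quantities). *)

theory Defs
  imports
    "HOL-Library.Multiset"
    "HOL-Combinatorics.Permutations"
    "Jordan_Normal_Form.Matrix"
begin

text \<open>
  An IEEE 754 binary format is given by its precision p (the number of significant bits) and its
  maximal exponent emax; the standard sets emin = 1 - emax. For instance binary64 is (53, 1023),
  binary32 is (24, 127) and binary16 is (11, 15). The finite numbers of the format are the
  c * 2^q with integers c, q such that c has at most p bits and emin <= q + p - 1 <= emax; this
  covers both normalized and subnormal numbers. Real numbers identify the signed zeros.
\<close>

definition fp_numbers :: "nat \<Rightarrow> nat \<Rightarrow> real set" where
  "fp_numbers p emax = {of_int c * 2 powi q | c q :: int.
     \<bar>c\<bar> < 2 ^ p \<and> 1 - int emax \<le> q + int p - 1 \<and> q + int p - 1 \<le> int emax}"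

definition fp_min_normal :: "nat \<Rightarrow> real" where
  "fp_min_normal emax = 2 powi (1 - int emax)"

definition fp_max :: "nat \<Rightarrow> nat \<Rightarrow> real" where
  "fp_max p emax = (2 - 2 powi (1 - int p)) * 2 ^ emax"

definition within_exponent_range :: "nat \<Rightarrow> nat \<Rightarrow> real \<Rightarrow> bool" where
  "within_exponent_range p emax x \<longleftrightarrow> fp_min_normal emax \<le> x \<and> x \<le> fp_max p emax"

text \<open>
  Neither the tie-breaking rule nor the outcome of an overflow is fixed: \<open>fl\<close> is arbitrary
  beyond the largest finite number, so results for all such \<open>fl\<close> cannot rely on any
  particular treatment of overflow.
\<close>

definition rounds_to_nearest :: "nat \<Rightarrow> nat \<Rightarrow> (real \<Rightarrow> real) \<Rightarrow> bool" where
  "rounds_to_nearest p emax fl \<longleftrightarrow>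
     (\<forall>x. \<bar>x\<bar> \<le> fp_max p emax \<longrightarrow>
        fl x \<in> fp_numbers p emax \<and> (\<forall>y \<in> fp_numbers p emax. \<bar>x - fl x\<bar> \<le> \<bar>x - y\<bar>))"

text \<open>
  \<open>fp_sum fl M s\<close>: the value \<open>s\<close> is obtained by adding up the numbers in \<open>M\<close> with rounded
  additions, in some order and with some bracketing. A summation scheme may choose the order
  and the bracketing depending on the list of summands.
\<close>

inductive fp_sum :: "(real \<Rightarrow> real) \<Rightarrow> real multiset \<Rightarrow> real \<Rightarrow> bool" for fl where
  single: "fp_sum fl {#x#} x"
| add: "fp_sum fl M a \<Longrightarrow> fp_sum fl N b \<Longrightarrow> fp_sum fl (M + N) (fl (a + b))"

definition summation_scheme :: "(real \<Rightarrow> real) \<Rightarrow> (real list \<Rightarrow> real) \<Rightarrow> bool" where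
  "summation_scheme fl sm \<longleftrightarrow> (\<forall>xs. xs \<noteq> [] \<longrightarrow> fp_sum fl (mset xs) (sm xs))"

text \<open>
  The operations below are parameterized by a rounding function \<open>fl\<close> and a summation function
  \<open>sm\<close>. Exact arithmetic is the instance where \<open>fl\<close> is the identity and \<open>sm\<close> is
  \<^const>\<open>sum_list\<close>.
\<close>

definition fl_dot :: "(real \<Rightarrow> real) \<Rightarrow> (real list \<Rightarrow> real) \<Rightarrow> real vec \<Rightarrow> real vec \<Rightarrow> real" where
  "fl_dot fl sm x y = sm (map (\<lambda>j. fl (x $ j * y $ j)) [0..<dim_vec y])"

definition fl_mat_vec ::
    "(real \<Rightarrow> real) \<Rightarrow> (real list \<Rightarrow> real) \<Rightarrow> real mat \<Rightarrow> real vec \<Rightarrow> real vec" where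
  "fl_mat_vec fl sm A x = vec (dim_row A) (\<lambda>i. fl_dot fl sm (row A i) x)"

definition fl_norm :: "(real \<Rightarrow> real) \<Rightarrow> (real list \<Rightarrow> real) \<Rightarrow> real vec \<Rightarrow> real" where
  "fl_norm fl sm z = fl (sqrt (fl_dot fl sm z z))"

definition fl_smult :: "(real \<Rightarrow> real) \<Rightarrow> real \<Rightarrow> real vec \<Rightarrow> real vec" where
  "fl_smult fl c x = map_vec (\<lambda>t. fl (c * t)) x"

definition fl_diff :: "(real \<Rightarrow> real) \<Rightarrow> real vec \<Rightarrow> real vec \<Rightarrow> real vec" where
  "fl_diff fl x y = map_vec fl (x - y)"

definition fl_div :: "(real \<Rightarrow> real) \<Rightarrow> real vec \<Rightarrow> real \<Rightarrow> real vec" where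
  "fl_div fl x c = map_vec (\<lambda>t. fl (t / c)) x"

lemma fl_dot_exact: "fl_dot (\<lambda>x. x) sum_list x y = x \<bullet> y"
  unfolding fl_dot_def scalar_prod_def
  by (simp add: interv_sum_list_conv_sum_set_nat)

lemma fl_mat_vec_exact: "fl_mat_vec (\<lambda>x. x) sum_list A x = A *\<^sub>v x"
  unfolding fl_mat_vec_def mult_mat_vec_def fl_dot_exact ..

lemma fl_norm_exact: "fl_norm (\<lambda>x. x) sum_list z = sqrt (z \<bullet> z)"
  unfolding fl_norm_def fl_dot_exact ..

lemma fl_smult_exact: "fl_smult (\<lambda>x. x) c x = c \<cdot>\<^sub>v x"
  unfolding fl_smult_def by auto

lemma fl_diff_exact: "fl_diff (\<lambda>x. x) x y = x - y"
  unfolding fl_diff_def by auto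

lemma fl_div_exact: "fl_div (\<lambda>x. x) x c = (1 / c) \<cdot>\<^sub>v x"
  unfolding fl_div_def by auto

text \<open>
  Pass i of the Lanczos loop records w, alpha_i, z, beta_{i+1} and v_{i+1}; the last of these is
  \<^const>\<open>None\<close> if the algorithm stops in this pass because beta_{i+1} = 0.
\<close>

record lanczos_pass =
  pass_w :: "real vec"
  pass_alpha :: real
  pass_z :: "real vec"
  pass_beta :: real
  pass_v :: "real vec option"

text \<open>
  In \<open>lanczos_loop fl sm A k u v b\<close>, at most \<open>k\<close> passes remain, and \<open>u\<close>, \<open>v\<close>, \<open>b\<close> are
  v_{i-1}, v_i, beta_i at the start of pass i.
\<close>

fun lanczos_loop ::
    "(real \<Rightarrow> real) \<Rightarrow> (real list \<Rightarrow> real) \<Rightarrow> real mat \<Rightarrow> nat \<Rightarrow>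
     real vec \<Rightarrow> real vec \<Rightarrow> real \<Rightarrow> lanczos_pass list" where
  "lanczos_loop fl sm A 0 u v b = []"
| "lanczos_loop fl sm A (Suc k) u v b =
    (let w = fl_diff fl (fl_mat_vec fl sm A v) (fl_smult fl b u);
         a = fl_dot fl sm w v;
         z = fl_diff fl w (fl_smult fl a v);
         b' = fl_norm fl sm z
     in if b' = 0
        then [\<lparr>pass_w = w, pass_alpha = a, pass_z = z, pass_beta = b', pass_v = None\<rparr>]
        else (let v' = fl_div fl z b'
              in \<lparr>pass_w = w, pass_alpha = a, pass_z = z, pass_beta = b', pass_v = Some v'\<rparr>
                 # lanczos_loop fl sm A k v v' b'))"

record lanczos_run =
  run_beta1 :: real
  run_v1 :: "real vec"
  run_passes :: "lanczos_pass list"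

definition lanczos ::
    "(real \<Rightarrow> real) \<Rightarrow> (real list \<Rightarrow> real) \<Rightarrow> real mat \<Rightarrow> real vec \<Rightarrow> lanczos_run" where
  "lanczos fl sm A v =
    (let n = dim_row A;
         b1 = fl_norm fl sm v;
         v1 = fl_div fl v b1
     in \<lparr>run_beta1 = b1, run_v1 = v1, run_passes = lanczos_loop fl sm A n (0\<^sub>v n) v1 b1\<rparr>)"

definition exact_lanczos :: "real mat \<Rightarrow> real vec \<Rightarrow> lanczos_run" where
  "exact_lanczos = lanczos (\<lambda>x. x) sum_list"

text \<open>
  Equality of the two records means equality of all the assigned quantities, and that both runs
  stop in the same pass.
\<close>

definition lanczos_computes_exactly ::
    "(real \<Rightarrow> real) \<Rightarrow> (real list \<Rightarrow> real) \<Rightarrow> real mat \<Rightarrow> real vec \<Rightarrow> bool" where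
  "lanczos_computes_exactly fl sm A v \<longleftrightarrow> lanczos fl sm A v = exact_lanczos A v"

text \<open>The coefficients alpha_i and beta_i are numbered from 1, the list of passes from 0.\<close>

definition run_alpha :: "lanczos_run \<Rightarrow> nat \<Rightarrow> real" where
  "run_alpha r i = pass_alpha (run_passes r ! (i - 1))"

definition run_beta :: "lanczos_run \<Rightarrow> nat \<Rightarrow> real" where
  "run_beta r i = (if i = 1 then run_beta1 r else pass_beta (run_passes r ! (i - 2)))"

text \<open>
  The symmetric tridiagonal matrix with diagonal a 1, ..., a n and off-diagonal b 2, ..., b n.
  The matrix indices start at 0, so the entry b j couples the indices j - 2 and j - 1.
\<close>

definition sym_tridiag_mat :: "nat \<Rightarrow> (nat \<Rightarrow> real) \<Rightarrow> (nat \<Rightarrow> real) \<Rightarrow> real mat" where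
  "sym_tridiag_mat n a b = mat n n (\<lambda>(i, j).
     if i = j then a (i + 1)
     else if j = i + 1 then b (j + 1)
     else if i = j + 1 then b (i + 1)
     else 0)"

definition lanczos_T :: "nat \<Rightarrow> lanczos_run \<Rightarrow> real mat" where
  "lanczos_T k r = sym_tridiag_mat k (run_alpha r) (run_beta r)"

definition signed_permutation_mat :: "nat \<Rightarrow> real mat \<Rightarrow> bool" where
  "signed_permutation_mat n P \<longleftrightarrow>
     (\<exists>\<pi> s. \<pi> permutes {..<n} \<and> (\<forall>j<n. s j = 1 \<or> s j = -1) \<and>
        P = mat n n (\<lambda>(i, j). if i = \<pi> j then s j else 0))"

end

theory Submission
  imports Defs
begin

text \<open>
  The Lanczos vectors of this problem are the signed unit vectors \<open>u\<^sub>i = P e\<^sub>i\<close>, and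
  \<open>A u\<^sub>i = b\<^sub>i u\<^bsub>i-1\<^esub> + a\<^sub>i u\<^sub>i + b\<^bsub>i+1\<^esub> u\<^bsub>i+1\<^esub>\<close>. Hence every inner product that the algorithm
  forms has at most one nonzero term, every product outside of the norms has a factor \<open>0\<close> or \<open>\<plusminus>1\<close>,
  every difference is between equal numbers or subtracts zero, and every quotient is \<open>0\<close> or
  \<open>\<plusminus>1\<close>. All these operations are exact on numbers of the format, whatever the order of
  summation. The one place where rounding can happen is a norm: its value is the rounded square
  root of the rounded \<open>b\<^sub>j\<^sup>2\<close>.

  That this is \<open>b\<^sub>j\<close> again is the heart of the matter (\<open>rounded_sqrt_of_rounded_square\<close>). The
  relative error \<open>2\<^sup>-\<^sup>p\<close> of the square is about halved by the square root, so the root is off by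
  slightly less than half of the spacing of the format at \<open>b\<^sub>j\<close>, and rounding to nearest gets
  back to \<open>b\<^sub>j\<close>. A power of two has closer neighbours below than above, but its square is
  represented exactly.

  The run is computed only once, for any arithmetic that is exact on sums with one nonzero term
  and that recovers the \<open>b\<^sub>j\<close> from their squares (\<open>lanczos_run\<close>). Rounded arithmetic is one
  instance, exact arithmetic another; so the two runs agree, and their coefficients can be
  read off.
\<close>

section \<open>Rounding to nearest\<close>

lemma exists_binary_exponent:
  fixes x :: real
  assumes "0 < x"
  obtains e :: int where "2 powi e \<le> x" "x < 2 powi (e + 1)"
proof
  define e where "e = \<lfloor>log 2 x\<rfloor>"
  have "2 powr of_int e \<le> x"
    using assms by (simp add: e_def powr_le_iff)
  then show "2 powi e \<le> x" by (simp add: powr_real_of_int')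
  have "x < 2 powr of_int (e + 1)"
    using assms unfolding e_def by (simp add: less_powr_iff del: of_int_add) linarith
  also have "2 powr of_int (e + 1) = (2::real) powi (e + 1)" by (rule powr_real_of_int') auto
  finally show "x < 2 powi (e + 1)" .
qed

lemma powi_two_less_iff: "(2::real) powi i < 2 powi j \<longleftrightarrow> i < j"
  using power_int_strict_increasing[of i j "2::real"] power_int_increasing[of j i "2::real"]
  by linarith

lemma powi_two_le_iff: "(2::real) powi i \<le> 2 powi j \<longleftrightarrow> i \<le> j"
  using powi_two_less_iff[of j i] by linarith

lemma powi_two_nonneg_exponent:
  assumes "0 \<le> i"
  shows "(2::real) powi i = of_int (2 ^ nat i)"
  using assms by (simp add: power_int_def)

lemma fp_max_altdef: "fp_max p emax = (2 ^ p - 1) * 2 powi (int emax - int p + 1)"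
proof -
  have "2 ^ p * 2 powi (int emax - int p + 1) = (2::real) powi (int emax + 1)"
    by (simp flip: power_int_of_nat add: power_int_add [symmetric])
  moreover have "2 powi (1 - int p) * 2 ^ emax = (2::real) powi (int emax - int p + 1)"
    by (simp flip: power_int_of_nat add: power_int_add [symmetric] algebra_simps)
  moreover have "(2::real) powi (int emax + 1) = 2 * 2 ^ emax"
    by (simp add: power_int_add)
  ultimately show ?thesis
    unfolding fp_max_def by (simp add: algebra_simps)
qed

lemma fp_max_less: "fp_max p emax < 2 powi (int emax + 1)"
proof -
  have "(0::real) < 2 powi (1 - int p) * 2 ^ emax" by simp
  then show ?thesis by (simp add: fp_max_def algebra_simps power_int_add)
qed

lemma fp_numbers_bounded:
  assumes "x \<in> fp_numbers p emax"
  shows "\<bar>x\<bar> \<le> fp_max p emax"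
proof -
  obtain c q :: int where x: "x = of_int c * 2 powi q" and c: "\<bar>c\<bar> < 2 ^ p"
    and q: "q + int p - 1 \<le> int emax"
    using assms unfolding fp_numbers_def by blast
  have "\<bar>c\<bar> \<le> 2 ^ p - 1" using c by simp
  then have "of_int \<bar>c\<bar> \<le> (of_int (2 ^ p - 1) :: real)" by (simp only: of_int_le_iff)
  moreover have "(2::real) powi q \<le> 2 powi (int emax - int p + 1)"
    unfolding powi_two_le_iff using q by simp
  ultimately have "of_int \<bar>c\<bar> * 2 powi q \<le> (2 ^ p - 1 :: real) * 2 powi (int emax - int p + 1)"
    by (intro mult_mono) auto
  then show ?thesis
    by (simp add: x abs_mult fp_max_altdef)
qed

lemma uminus_fp_numbers:
  assumes "x \<in> fp_numbers p emax"
  shows "- x \<in> fp_numbers p emax"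
proof -
  obtain c q :: int where "x = of_int c * 2 powi q" "\<bar>c\<bar> < 2 ^ p"
    "1 - int emax \<le> q + int p - 1" "q + int p - 1 \<le> int emax"
    using assms unfolding fp_numbers_def by blast
  then show ?thesis
    unfolding fp_numbers_def by (intro CollectI exI[of _ "- c"] exI[of _ q]) simp
qed

lemma zero_fp_numbers: "1 \<le> emax \<Longrightarrow> 0 \<in> fp_numbers p emax"
  unfolding fp_numbers_def by (intro CollectI exI[of _ 0] exI[of _ "1 - int p"]) simp

lemma powi_two_fp_numbers:
  assumes "1 \<le> p" "1 - int emax \<le> e" "e \<le> int emax"
  shows "2 powi e \<in> fp_numbers p emax"
proof -
  have "(2::real) powi e = 2 powi (int p - 1) * 2 powi (e - int p + 1)"
    by (simp add: power_int_add [symmetric])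
  also have "(2::real) powi (int p - 1) = of_int (2 ^ (p - 1))"
    using assms by (simp add: powi_two_nonneg_exponent nat_diff_distrib)
  finally show ?thesis
    unfolding fp_numbers_def using assms
    by (intro CollectI exI[of _ "2 ^ (p - 1)"] exI[of _ "e - int p + 1"]) auto
qed

lemma one_fp_numbers:
  assumes "1 \<le> p" "1 \<le> emax"
  shows "1 \<in> fp_numbers p emax"
  using powi_two_fp_numbers[of p emax 0] assms by simp

lemma rounds_to_nearest_fixes_fp_numbers:
  assumes "rounds_to_nearest p emax fl" "x \<in> fp_numbers p emax"
  shows "fl x = x"
  using assms fp_numbers_bounded[OF assms(2)] unfolding rounds_to_nearest_def by fastforce

text \<open>
  With \<open>t\<close> in the binade \<open>[2\<^sup>e, 2\<^bsup>e+1\<^esup>)\<close>, the multiples of the unit in the last place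
  \<open>2\<^bsup>e-p+1\<^esup>\<close> come within half a unit of \<open>t\<close>, and that is at most \<open>2\<^sup>e / 2\<^sup>p \<le> t / 2\<^sup>p\<close>.
\<close>

lemma exists_fp_number_near:
  assumes p: "1 \<le> p" and t: "within_exponent_range p emax t"
  obtains f where "f \<in> fp_numbers p emax" "\<bar>t - f\<bar> \<le> t / 2 ^ p"
proof -
  have t_ge: "2 powi (1 - int emax) \<le> t" and t_le: "t \<le> fp_max p emax"
    using t unfolding within_exponent_range_def fp_min_normal_def by auto
  have "0 < (2::real) powi (1 - int emax)" by simp
  with t_ge have t_pos: "0 < t" by linarith
  obtain e where e: "2 powi e \<le> t" "t < 2 powi (e + 1)"
    using exists_binary_exponent[OF t_pos] .
  have e_ge: "1 - int emax \<le> e"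
    using order.strict_trans1[OF t_ge e(2)] unfolding powi_two_less_iff by simp
  have e_le: "e \<le> int emax"
    using order.strict_trans1[OF order.trans[OF e(1) t_le] fp_max_less]
    unfolding powi_two_less_iff by simp
  define q where "q = e - int p + 1"
  have t_less: "t < 2 ^ p * 2 powi q"
    using e(2) by (simp add: q_def flip: power_int_of_nat power_int_add)
  have half: "2 powi q / 2 \<le> t / 2 ^ p"
  proof -
    have "2 powi q / 2 * 2 ^ p = (2::real) powi e"
      by (simp add: q_def power_int_add power_int_diff)
    with e(1) show ?thesis by (simp add: field_simps)
  qed
  define c where "c = round (t / 2 powi q)"
  have c_near: "\<bar>of_int c - t / 2 powi q\<bar> \<le> 1 / 2"
    unfolding c_def by (rule of_int_round_abs_le)
  have "of_int c * 2 powi q - t = (of_int c - t / 2 powi q) * 2 powi q"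
    by (simp add: left_diff_distrib)
  then have "\<bar>t - of_int c * 2 powi q\<bar> = \<bar>of_int c - t / 2 powi q\<bar> * 2 powi q"
    by (simp add: abs_minus_commute[of t] abs_mult)
  also have "\<dots> \<le> 1 / 2 * 2 powi q"
    using c_near by (intro mult_right_mono) auto
  finally have near: "\<bar>t - of_int c * 2 powi q\<bar> \<le> t / 2 ^ p"
    using half by linarith
  have c_nonneg: "0 \<le> c"
    unfolding c_def using t_pos by (simp add: round_def)
  show thesis
  proof (cases "c < 2 ^ p")
    case True
    then have "of_int c * 2 powi q \<in> fp_numbers p emax"
      unfolding fp_numbers_def using c_nonneg e_ge e_le
      by (intro CollectI exI[of _ c] exI[of _ q]) (auto simp: q_def)
    with near show thesis by (rule that[rotated])
  next
    case False
    \<comment> \<open>The significand is rounded up to the next power of two; below the overflow threshold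
      this power is still a number of the format.\<close>
    have "t / 2 powi q < 2 ^ p" using t_less by (simp add: field_simps)
    then have "of_int c < (2 ^ p + 1 :: real)" using c_near by linarith
    then have "of_int c < (of_int (2 ^ p + 1) :: real)" by simp
    with False have c: "c = 2 ^ p" by (simp only: of_int_less_iff)
    have "e \<noteq> int emax"
    proof
      assume "e = int emax"
      then have "t \<le> (2 ^ p - 1) * 2 powi q"
        using t_le by (simp add: fp_max_altdef q_def)
      then have "t / 2 powi q \<le> 2 ^ p - 1" by (simp add: field_simps)
      with c_near c show False by simp
    qed
    then have "2 powi (e + 1) \<in> fp_numbers p emax"
      using p e_ge e_le by (intro powi_two_fp_numbers) auto
    also have "(2::real) powi (e + 1) = of_int c * 2 powi q"
      by (simp add: c q_def flip: power_int_of_nat power_int_add)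
    finally show thesis using near by (rule that)
  qed
qed

lemma rounds_to_nearest_relative_error:
  assumes "1 \<le> p" "rounds_to_nearest p emax fl" "within_exponent_range p emax t"
  shows "\<bar>t - fl t\<bar> \<le> t / 2 ^ p"
proof -
  obtain f where f: "f \<in> fp_numbers p emax" "\<bar>t - f\<bar> \<le> t / 2 ^ p"
    using exists_fp_number_near[OF assms(1,3)] .
  have "0 < fp_min_normal emax" by (simp add: fp_min_normal_def)
  then have "\<bar>t\<bar> \<le> fp_max p emax"
    using assms(3) unfolding within_exponent_range_def by linarith
  then have "\<bar>t - fl t\<bar> \<le> \<bar>t - f\<bar>"
    using assms(2) f(1) unfolding rounds_to_nearest_def by blast
  with f(2) show ?thesis by linarith
qed

text \<open>
  Strictly inside a binade both neighbours are at least one unit in the last place away. At the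
  power of two \<open>m = 2\<^bsup>p-1\<^esup>\<close> this can fail, because the numbers below may be twice as dense.
\<close>

lemma fp_numbers_gap:
  assumes m: "2 ^ (p - 1) < m" and p: "1 \<le> p"
    and z: "z \<in> fp_numbers p emax" and neq: "z \<noteq> of_int m * 2 powi q"
  shows "2 powi q \<le> \<bar>z - of_int m * 2 powi q\<bar>"
proof -
  obtain c r :: int where z_eq: "z = of_int c * 2 powi r" and c: "\<bar>c\<bar> < 2 ^ p"
    using z unfolding fp_numbers_def by blast
  show ?thesis
  proof (cases "q \<le> r")
    case True
    \<comment> \<open>Both numbers are integer multiples of the unit.\<close>
    define d where "d = c * 2 ^ nat (r - q) - m"
    have "(2::real) powi r = 2 powi (r - q) * 2 powi q"
      by (simp add: power_int_add [symmetric])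
    then have diff: "z - of_int m * 2 powi q = of_int d * 2 powi q"
      using True by (simp add: z_eq d_def powi_two_nonneg_exponent algebra_simps)
    with neq have "d \<noteq> 0" by auto
    then have "1 \<le> \<bar>of_int d :: real\<bar>" by linarith
    then have "1 * 2 powi q \<le> \<bar>of_int d :: real\<bar> * 2 powi q"
      by (intro mult_right_mono) auto
    with diff show ?thesis by (simp add: abs_mult)
  next
    case False
    \<comment> \<open>A finer exponent forces the other number down to the lower end of the binade.\<close>
    have "of_int c \<le> (of_int (2 ^ p) :: real)" using c by (simp only: of_int_le_iff)
    then have "z \<le> 2 ^ p * 2 powi r"
      unfolding z_eq by (intro mult_right_mono) auto
    also have "\<dots> = 2 powi (int p + r)" by (simp add: power_int_add)
    also have "\<dots> \<le> 2 powi (int (p - 1) + q)"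
      unfolding powi_two_le_iff using False p by simp
    also have "\<dots> = 2 ^ (p - 1) * 2 powi q" by (simp add: power_int_add)
    finally have z_le: "z \<le> 2 ^ (p - 1) * 2 powi q" .
    have "2 ^ (p - 1) + 1 \<le> m" using m by simp
    then have "of_int (2 ^ (p - 1) + 1) \<le> (of_int m :: real)" by (simp only: of_int_le_iff)
    then have "(2 ^ (p - 1) + 1) * 2 powi q \<le> of_int m * (2::real) powi q"
      by (intro mult_right_mono) auto
    with z_le show ?thesis by (simp add: algebra_simps)
  qed
qed

text \<open>
  The exponent \<open>q\<close> may lie below the range of the format when \<open>x\<close> is subnormal; it
  serves only to bound the distance from \<open>x\<close> to other numbers of the format from below.
\<close>

lemma fp_number_normalized:
  assumes p: "1 \<le> p" and x: "x \<in> fp_numbers p emax" "0 < x"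
  obtains m q :: int where "x = of_int m * 2 powi q" "2 ^ (p - 1) \<le> m" "m < 2 ^ p"
proof -
  obtain c r :: int where x_eq: "x = of_int c * 2 powi r" and c: "\<bar>c\<bar> < 2 ^ p"
    using x unfolding fp_numbers_def by blast
  obtain e where e: "2 powi e \<le> x" "x < 2 powi (e + 1)"
    using exists_binary_exponent[OF x(2)] .
  define q where "q = e - int p + 1"
  have "of_int c < (of_int (2 ^ p) :: real)" using c by (simp only: of_int_less_iff)
  then have "x < 2 ^ p * 2 powi r" by (simp add: x_eq)
  also have "\<dots> = 2 powi (int p + r)" by (simp add: power_int_add)
  finally have "2 powi e < (2::real) powi (int p + r)" using e(1) by linarith
  then have qr: "q \<le> r" unfolding powi_two_less_iff q_def by simp
  define m where "m = c * 2 ^ nat (r - q)"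
  have "(2::real) powi r = 2 powi (r - q) * 2 powi q"
    by (simp add: power_int_add [symmetric])
  then have xm: "x = of_int m * 2 powi q"
    using qr by (simp add: x_eq m_def powi_two_nonneg_exponent)
  have "(2::real) powi e = 2 ^ (p - 1) * 2 powi q"
    using p by (simp add: q_def flip: power_int_of_nat power_int_add)
  with e(1) have "of_int (2 ^ (p - 1)) \<le> (of_int m :: real)" by (simp add: xm)
  then have lower: "2 ^ (p - 1) \<le> m" by (simp only: of_int_le_iff)
  have "(2::real) powi (e + 1) = 2 ^ p * 2 powi q"
    by (simp add: q_def flip: power_int_of_nat power_int_add)
  with e(2) have "(of_int m :: real) < of_int (2 ^ p)" by (simp add: xm)
  then have upper: "m < 2 ^ p" by (simp only: of_int_less_iff)
  from xm lower upper show thesis by (rule that)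
qed

lemma rounds_to_nearest_in_fp_numbers:
  assumes "rounds_to_nearest p emax fl" "within_exponent_range p emax t"
  shows "fl t \<in> fp_numbers p emax"
proof -
  have "0 < fp_min_normal emax" by (simp add: fp_min_normal_def)
  then have "\<bar>t\<bar> \<le> fp_max p emax"
    using assms(2) unfolding within_exponent_range_def by linarith
  then show ?thesis using assms(1) unfolding rounds_to_nearest_def by blast
qed

text \<open>
  Since \<open>sqrt y - x = (y - x\<^sup>2) / (sqrt y + x)\<close> and \<open>sqrt y \<ge> (1 - u) x\<close>, the relative error \<open>u\<close>
  of the square shrinks to \<open>u / (2 - u)\<close>. The bound \<open>u / 2\<close> would be false for \<open>y < x\<^sup>2\<close>.
\<close>

lemma sqrt_near:
  fixes x y u :: real
  assumes x: "0 < x" and u: "0 < u" "u < 1" and y: "\<bar>x\<^sup>2 - y\<bar> \<le> u * x\<^sup>2"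
  shows "\<bar>sqrt y - x\<bar> * (2 - u) \<le> u * x"
proof -
  have "(1 - u) * x\<^sup>2 \<le> y" using y by (simp add: abs_if algebra_simps split: if_splits)
  moreover have "(1 - u)\<^sup>2 * x\<^sup>2 \<le> (1 - u) * x\<^sup>2"
    using u by (intro mult_right_mono) (auto simp: power2_eq_square mult_left_le)
  then have "((1 - u) * x)\<^sup>2 \<le> (1 - u) * x\<^sup>2" by (simp only: power_mult_distrib)
  ultimately have le: "((1 - u) * x)\<^sup>2 \<le> y" by linarith
  then have y0: "0 \<le> y" using zero_le_power2 order.trans by blast
  have s: "(1 - u) * x \<le> sqrt y" using le by (rule real_le_rsqrt)
  have "\<bar>sqrt y - x\<bar> * (2 - u) * x = \<bar>sqrt y - x\<bar> * ((1 - u) * x + x)"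
    by (simp add: algebra_simps)
  also have "\<dots> \<le> \<bar>sqrt y - x\<bar> * (sqrt y + x)"
    using s by (intro mult_left_mono) auto
  also have "\<dots> = \<bar>(sqrt y - x) * (sqrt y + x)\<bar>"
    using x y0 by (simp add: abs_mult)
  also have "(sqrt y - x) * (sqrt y + x) = y - x\<^sup>2"
    using y0 by (simp add: algebra_simps power2_eq_square)
  also have "\<bar>y - x\<^sup>2\<bar> \<le> u * x * x"
    using y by (simp add: abs_minus_commute power2_eq_square mult.assoc)
  finally show ?thesis using x by simp
qed

text \<open>
  The error of the root is at most \<open>u x / (2 - u)\<close> with \<open>u = 2\<^sup>-\<^sup>p\<close>. It has to stay strictly below
  half the spacing \<open>2\<^sup>q\<close> at \<open>x = m 2\<^sup>q\<close>, so that no tie can arise. This works because the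
  significand is at most \<open>2\<^sup>p - 1\<close>: then \<open>u x \<le> (1 - u) 2\<^sup>q\<close>, and \<open>(1 - u) / (2 - u) < 1 / 2\<close>.
\<close>

theorem rounded_sqrt_of_rounded_square:
  assumes p: "1 \<le> p" and emax: "1 \<le> emax" and fl: "rounds_to_nearest p emax fl"
    and x: "x \<in> fp_numbers p emax" "0 < x" and range: "within_exponent_range p emax (x\<^sup>2)"
  shows "fl (sqrt (fl (x\<^sup>2))) = x"
proof -
  define y where "y = fl (x\<^sup>2)"
  obtain m q where xm: "x = of_int m * 2 powi q" and m: "2 ^ (p - 1) \<le> m" "m < 2 ^ p"
    using fp_number_normalized[OF p x] .
  show ?thesis
  proof (cases "m = 2 ^ (p - 1)")
    case True
    \<comment> \<open>The square of a power of two is again a power of two, hence not rounded.\<close>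
    define e where "e = 2 * (int (p - 1) + q)"
    have x2: "x\<^sup>2 = 2 powi e"
      by (simp add: xm True e_def power2_eq_square power_int_add flip: power_int_add)
        (simp flip: power_int_of_nat power_int_add)
    have "2 powi (1 - int emax) \<le> (2::real) powi e" "(2::real) powi e < 2 powi (int emax + 1)"
      using range fp_max_less[of p emax]
      unfolding within_exponent_range_def fp_min_normal_def x2 by linarith+
    then have "2 powi e \<in> fp_numbers p emax"
      using p unfolding powi_two_le_iff powi_two_less_iff by (intro powi_two_fp_numbers) auto
    then have "fl (x\<^sup>2) = x\<^sup>2" using fl rounds_to_nearest_fixes_fp_numbers x2 by simp
    then show ?thesis using x fl rounds_to_nearest_fixes_fp_numbers by simp
  next
    case False
    with m have m_less: "2 ^ (p - 1) < m" by simp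
    define u :: real where "u = 1 / 2 ^ p"
    have u: "0 < u" "u < 1" using p by (simp_all add: u_def)
    have "\<bar>x\<^sup>2 - y\<bar> \<le> u * x\<^sup>2"
      using rounds_to_nearest_relative_error[OF p fl range] by (simp add: y_def u_def)
    then have near: "\<bar>sqrt y - x\<bar> * (2 - u) \<le> u * x" by (rule sqrt_near[OF x(2) u])
    have "m \<le> 2 ^ p - 1" using m by simp
    then have "of_int m \<le> (of_int (2 ^ p - 1) :: real)" by (simp only: of_int_le_iff)
    then have "u * of_int m \<le> 1 - u" by (simp add: u_def field_simps)
    then have "u * of_int m * 2 powi q \<le> (1 - u) * 2 powi q" by (intro mult_right_mono) auto
    then have "u * x \<le> (1 - u) * 2 powi q" by (simp add: xm mult.assoc)
    also have "\<dots> < (2 - u) * (2 powi q / 2)" using u by (simp add: field_simps)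
    finally have "\<bar>sqrt y - x\<bar> * (2 - u) < 2 powi q / 2 * (2 - u)" using near by (simp add: mult.commute)
    then have close: "\<bar>sqrt y - x\<bar> < 2 powi q / 2" using u by simp
    have y_F: "y \<in> fp_numbers p emax"
      unfolding y_def using rounds_to_nearest_in_fp_numbers[OF fl range] .
    \<comment> \<open>The root does not overflow: it is at most the larger of 1 and its square.\<close>
    have "1 \<le> fp_max p emax"
      using fp_numbers_bounded[OF one_fp_numbers[OF p emax]] by simp
    moreover have "y \<le> fp_max p emax" using fp_numbers_bounded[OF y_F] by simp
    moreover have "0 \<le> y"
    proof -
      have "u * x\<^sup>2 \<le> 1 * x\<^sup>2" using u by (intro mult_right_mono) auto
      with \<open>\<bar>x\<^sup>2 - y\<bar> \<le> u * x\<^sup>2\<close> show ?thesis by linarith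
    qed
    moreover have "sqrt y \<le> max 1 y"
    proof (cases "y \<le> 1")
      case False
      then have "y * 1 \<le> y * y" by (intro mult_left_mono) auto
      then show ?thesis using False by (intro real_le_lsqrt) (auto simp: power2_eq_square)
    qed auto
    ultimately have "\<bar>sqrt y\<bar> \<le> fp_max p emax" by auto
    then have "fl (sqrt y) \<in> fp_numbers p emax" and "\<bar>sqrt y - fl (sqrt y)\<bar> \<le> \<bar>sqrt y - x\<bar>"
      using fl x(1) unfolding rounds_to_nearest_def by blast+
    then have "\<not> 2 powi q \<le> \<bar>fl (sqrt y) - x\<bar>" using close by linarith
    then have "fl (sqrt y) = x"
      using fp_numbers_gap[OF m_less p \<open>fl (sqrt y) \<in> _\<close>] unfolding xm by blast
    then show ?thesis by (simp add: y_def)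
  qed
qed

section \<open>Rounded sums with at most one nonzero summand\<close>

text \<open>
  In every addition one operand is a sum of zeros, hence zero, and the other one is a number of
  \<open>F\<close>; so nothing is rounded. Membership in \<open>F\<close> is part of the conclusion to make the induction
  go through.
\<close>

lemma fp_sum_single_nonzero:
  assumes "fp_sum fl M x" "set_mset M \<subseteq> F" "size {#t \<in># M. t \<noteq> 0#} \<le> 1"
    and "\<And>t. t \<in> F \<Longrightarrow> fl t = t" "0 \<in> F"
  shows "x = \<Sum>\<^sub># M \<and> x \<in> F"
  using assms(1-3)
proof (induction rule: fp_sum.induct)
  case (add M a N b)
  have *: "\<Sum>\<^sub># K = 0" if "{#t \<in># K. t \<noteq> 0#} = {#}" for K :: "real multiset"
    using that by (induction K) (auto split: if_splits)
  have "size {#t \<in># M. t \<noteq> 0#} + size {#t \<in># N. t \<noteq> 0#} \<le> 1"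
    using add.prems(2) by simp
  then consider "{#t \<in># M. t \<noteq> 0#} = {#}" | "{#t \<in># N. t \<noteq> 0#} = {#}"
    by (cases "size {#t \<in># M. t \<noteq> 0#}") auto
  then show ?case
  proof cases
    case 1
    with * add assms show ?thesis by auto
  next
    case 2
    with * add assms show ?thesis by auto
  qed
qed auto

lemma summation_scheme_single_nonzero:
  assumes "summation_scheme fl sm" "\<And>t. t \<in> F \<Longrightarrow> fl t = t" "0 \<in> F" "c \<in> F" "j0 < n"
  shows "sm (map (\<lambda>j. if j = j0 then c else 0) [0..<n]) = c"
proof -
  let ?xs = "map (\<lambda>j. if j = j0 then c else 0) [0..<n]"
  have "fp_sum fl (mset ?xs) (sm ?xs)"
    using assms(1)[unfolded summation_scheme_def, rule_format, of ?xs] assms(5) by simp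
  moreover have "set_mset (mset ?xs) \<subseteq> F" using assms by auto
  moreover have "size {#t \<in># mset ?xs. t \<noteq> 0#} \<le> 1"
  proof -
    have "size {#t \<in># mset ?xs. t \<noteq> 0#} = length (filter (\<lambda>t. t \<noteq> 0) ?xs)"
      by (simp only: flip: mset_filter size_mset)
    also have "\<dots> \<le> card {j0}"
      unfolding length_filter_conv_card by (intro card_mono) (auto split: if_splits)
    finally show ?thesis by simp
  qed
  ultimately have "sm ?xs = \<Sum>\<^sub># (mset ?xs)"
    using fp_sum_single_nonzero assms(2,3) by blast
  also have "\<dots> = sum_list ?xs" by (rule sum_mset_sum_list)
  also have "\<dots> = c"
    using assms(5) by (simp add: interv_sum_list_conv_sum_set_nat)
  finally show ?thesis .
qed


section \<open>Arithmetic that is exact on these sums\<close>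

text \<open>
  The set \<open>F\<close> collects the numbers that are not rounded. Exact arithmetic satisfies the axioms
  with \<open>F = UNIV\<close>, rounded arithmetic with the numbers of the format.
\<close>

locale single_term_arithmetic =
  fixes fl :: "real \<Rightarrow> real" and sm :: "real list \<Rightarrow> real" and F :: "real set"
  assumes fl_F [simp]: "x \<in> F \<Longrightarrow> fl x = x"
    and zero_F [simp]: "0 \<in> F" and one_F [simp]: "1 \<in> F"
    and uminus_F [simp]: "x \<in> F \<Longrightarrow> - x \<in> F"
    and sm_single: "c \<in> F \<Longrightarrow> j0 < n \<Longrightarrow> sm (map (\<lambda>j. if j = j0 then c else 0) [0..<n]) = c"
begin

lemma fl_dot_single_nonzero:
  assumes "dim_vec y = n" "j0 < n" "fl (x $ j0 * y $ j0) \<in> F"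
    and "\<And>j. j < n \<Longrightarrow> j \<noteq> j0 \<Longrightarrow> x $ j * y $ j = 0"
  shows "fl_dot fl sm x y = fl (x $ j0 * y $ j0)"
proof -
  have "map (\<lambda>j. fl (x $ j * y $ j)) [0..<n]
      = map (\<lambda>j. if j = j0 then fl (x $ j0 * y $ j0) else 0) [0..<n]"
  proof (intro map_cong refl)
    fix j assume "j \<in> set [0..<n]"
    then show "fl (x $ j * y $ j) = (if j = j0 then fl (x $ j0 * y $ j0) else 0)"
      using assms(4)[of j] by (simp del: mult_eq_0_iff)
  qed
  then show ?thesis
    unfolding fl_dot_def assms(1) using sm_single[OF assms(3,2)] by (simp only:)
qed

text \<open>
  The square is rounded before the root is taken, so it need not lie in \<open>F\<close> itself; its rounded
  value must, to pass unchanged through the additions of zeros.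
\<close>

definition norm_recovers :: "real \<Rightarrow> bool" where
  "norm_recovers c \<longleftrightarrow> fl (c\<^sup>2) \<in> F \<and> fl (sqrt (fl (c\<^sup>2))) = c"

lemma norm_recovers_zero: "norm_recovers 0"
  by (simp add: norm_recovers_def)

lemma fl_norm_single_nonzero:
  assumes "dim_vec z = n" "j0 < n" "\<bar>z $ j0\<bar> = \<bar>c\<bar>" "norm_recovers c"
    and "\<And>j. j < n \<Longrightarrow> j \<noteq> j0 \<Longrightarrow> z $ j = 0"
  shows "fl_norm fl sm z = c"
proof -
  have sq: "z $ j0 * z $ j0 = c\<^sup>2"
    using assms(3) by (metis power2_abs power2_eq_square)
  have "fl_dot fl sm z z = fl (z $ j0 * z $ j0)"
    using assms sq by (intro fl_dot_single_nonzero[where n = n]) (auto simp: norm_recovers_def)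
  with sq assms(4) show ?thesis
    by (simp add: fl_norm_def norm_recovers_def)
qed

end

lemma exact_single_term_arithmetic: "single_term_arithmetic (\<lambda>x. x) sum_list UNIV"
  by unfold_locales (auto simp: interv_sum_list_conv_sum_set_nat)

lemma fp_single_term_arithmetic:
  assumes "1 \<le> p" "1 \<le> emax" "rounds_to_nearest p emax fl" "summation_scheme fl sm"
  shows "single_term_arithmetic fl sm (fp_numbers p emax)"
proof
  show fixes_F: "fl x = x" if "x \<in> fp_numbers p emax" for x
    using assms(3) that by (rule rounds_to_nearest_fixes_fp_numbers)
  show "sm (map (\<lambda>j. if j = j0 then c else 0) [0..<n]) = c"
    if "c \<in> fp_numbers p emax" "j0 < n" for c j0 n
    by (rule summation_scheme_single_nonzero[OF assms(4) fixes_F zero_fp_numbers[OF assms(2)] that])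
qed (use assms zero_fp_numbers one_fp_numbers uminus_fp_numbers in auto)

section \<open>The Lanczos run on a signed permutation of a tridiagonal matrix\<close>

definition signed_unit_vec :: "nat \<Rightarrow> (nat \<Rightarrow> nat) \<Rightarrow> (nat \<Rightarrow> real) \<Rightarrow> nat \<Rightarrow> real vec" where
  "signed_unit_vec n \<pi> s j = vec n (\<lambda>i. if i = \<pi> j then s j else 0)"

text \<open>
  Pass numbers start at 0 here, coefficient indices at 1. In the last pass \<open>i = n - 1\<close> the vector
  \<open>signed_unit_vec n \<pi> s n\<close> appears. It is zero, because a permutation of \<open>{..<n}\<close> fixes \<open>n\<close>;
  together with \<open>b (n + 1) = 0\<close> this lets one formula cover all passes.
\<close>

definition tridiagonal_pass ::
    "nat \<Rightarrow> (nat \<Rightarrow> nat) \<Rightarrow> (nat \<Rightarrow> real) \<Rightarrow> (nat \<Rightarrow> real) \<Rightarrow> (nat \<Rightarrow> real) \<Rightarrow> nat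
      \<Rightarrow> lanczos_pass" where
  "tridiagonal_pass n \<pi> s a b i =
    \<lparr>pass_w = a (i + 1) \<cdot>\<^sub>v signed_unit_vec n \<pi> s i + b (i + 2) \<cdot>\<^sub>v signed_unit_vec n \<pi> s (i + 1),
     pass_alpha = a (i + 1),
     pass_z = b (i + 2) \<cdot>\<^sub>v signed_unit_vec n \<pi> s (i + 1),
     pass_beta = b (i + 2),
     pass_v = (if i + 1 < n then Some (signed_unit_vec n \<pi> s (i + 1)) else None)\<rparr>"

locale signed_permuted_tridiagonal = single_term_arithmetic +
  fixes n :: nat and \<pi> :: "nat \<Rightarrow> nat" and s a b :: "nat \<Rightarrow> real" and A :: "real mat"
  assumes permutes: "\<pi> permutes {..<n}"
    and sign: "j < n \<Longrightarrow> s j = 1 \<or> s j = - 1"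
    and A_carrier: "A \<in> carrier_mat n n"
    and A_entry: "\<And>i j. i < n \<Longrightarrow> j < n \<Longrightarrow>
      A $$ (\<pi> i, \<pi> j) = s i * s j * sym_tridiag_mat n a b $$ (i, j)"
    and a_F: "\<And>i. i < n \<Longrightarrow> a (i + 1) \<in> F"
    and b_F: "\<And>i. i < n \<Longrightarrow> b (i + 1) \<in> F"
    and b_nonzero: "\<And>i. i < n \<Longrightarrow> b (i + 1) \<noteq> 0"
    and b_end: "b (n + 1) = 0"
    and b_recovers: "\<And>i. i < n \<Longrightarrow> norm_recovers (b (i + 1))"
begin

abbreviation "u \<equiv> signed_unit_vec n \<pi> s"

lemma perm_less: "\<pi> j < n \<longleftrightarrow> j < n"
  using permutes_in_image[OF permutes, of j] by simp

lemma perm_eq_iff: "\<pi> i = \<pi> j \<longleftrightarrow> i = j"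
  using permutes_inj[OF permutes] by (auto dest: injD)

lemma dim_u: "dim_vec (u j) = n"
  by (simp add: signed_unit_vec_def)

lemma u_entry: "k < n \<Longrightarrow> u j $ \<pi> k = (if k = j then s j else 0)"
  by (simp add: signed_unit_vec_def perm_less perm_eq_iff)

text \<open>
  All vectors are compared in the permuted coordinates \<open>\<pi> k\<close>, in which the matrix is tridiagonal
  up to signs.
\<close>

lemma eq_vec_permI:
  assumes "dim_vec x = n" "dim_vec y = n" "\<And>k. k < n \<Longrightarrow> x $ \<pi> k = y $ \<pi> k"
  shows "x = y"
proof (rule eq_vecI)
  fix i assume "i < dim_vec y"
  then have "i \<in> \<pi> ` {..<n}" using permutes_image[OF permutes] assms(2) by simp
  with assms(3) show "x $ i = y $ i" by auto
qed (simp add: assms)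

lemma sign_mult_F [simp]: "j < n \<Longrightarrow> x \<in> F \<Longrightarrow> s j * x \<in> F"
  using sign[of j] by auto

lemma mult_sign_F [simp]: "j < n \<Longrightarrow> x \<in> F \<Longrightarrow> x * s j \<in> F"
  using sign[of j] by auto

lemma sign_F [simp]: "j < n \<Longrightarrow> s j \<in> F"
  using sign[of j] by auto

lemma b_Suc_F: "i < n \<Longrightarrow> b (i + 2) \<in> F"
  using b_F[of "i + 1"] b_end by (cases "i + 1 < n") (auto simp: not_less le_less_Suc_eq dest: Suc_lessI)

lemma b_Suc_recovers: "i < n \<Longrightarrow> norm_recovers (b (i + 2))"
  using b_recovers[of "i + 1"] b_end norm_recovers_zero
  by (cases "i + 1 < n") (auto dest: Suc_lessI)

lemma tridiag_entry:
  assumes "k < n" "i < n"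
  shows "sym_tridiag_mat n a b $$ (k, i) =
    (if k = i then a (i + 1) else if k + 1 = i then b (i + 1) else if k = i + 1 then b (i + 2) else 0)"
  using assms by (auto simp: sym_tridiag_mat_def)

lemma tridiag_entry_F: "k < n \<Longrightarrow> i < n \<Longrightarrow> sym_tridiag_mat n a b $$ (k, i) \<in> F"
  using a_F[of i] b_F[of i] b_Suc_F[of i] by (simp add: tridiag_entry)

lemma fl_mat_vec_u:
  assumes "i < n" "k < n"
  shows "fl_mat_vec fl sm A (u i) $ \<pi> k = s k * sym_tridiag_mat n a b $$ (k, i)"
proof -
  let ?t = "s k * sym_tridiag_mat n a b $$ (k, i)"
  have row: "row A (\<pi> k) $ \<pi> j = s k * s j * sym_tridiag_mat n a b $$ (k, j)" if "j < n" for j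
    using A_carrier A_entry[OF assms(2) that] that assms(2) by (simp add: perm_less)
  have prod: "row A (\<pi> k) $ \<pi> i * u i $ \<pi> i = ?t"
    using row[OF assms(1)] assms sign[of i] by (auto simp: u_entry)
  have "fl_dot fl sm (row A (\<pi> k)) (u i) = fl (row A (\<pi> k) $ \<pi> i * u i $ \<pi> i)"
  proof (rule fl_dot_single_nonzero)
    show "row A (\<pi> k) $ j * u i $ j = 0" if "j < n" "j \<noteq> \<pi> i" for j
      using that by (simp add: signed_unit_vec_def)
  qed (use assms prod tridiag_entry_F in \<open>auto simp: dim_u perm_less\<close>)
  also have "\<dots> = ?t" using prod assms tridiag_entry_F by simp
  finally show ?thesis
    using A_carrier assms by (simp add: fl_mat_vec_def perm_less)
qed

lemma pass_w:
  assumes "i < n"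
  shows "fl_diff fl (fl_mat_vec fl sm A (u i))
      (fl_smult fl (b (i + 1)) (if i = 0 then 0\<^sub>v n else u (i - 1)))
    = a (i + 1) \<cdot>\<^sub>v u i + b (i + 2) \<cdot>\<^sub>v u (i + 1)"
  (is "fl_diff fl ?Au (fl_smult fl _ ?prev) = ?w")
proof (rule eq_vec_permI)
  have dims: "dim_vec ?Au = n" "dim_vec ?prev = n"
    using A_carrier by (auto simp: fl_mat_vec_def dim_u)
  then show "dim_vec (fl_diff fl ?Au (fl_smult fl (b (i + 1)) ?prev)) = n" "dim_vec ?w = n"
    by (auto simp: fl_diff_def fl_smult_def dim_u)
  fix k assume k: "k < n"
  \<comment> \<open>The subtraction cancels exactly the component along the previous vector: at the
    coordinate with \<open>k + 1 = i\<close> it subtracts a number from itself, elsewhere zero.\<close>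
  have prev: "?prev $ \<pi> k = (if k + 1 = i then s k else 0)"
    using k by (auto simp: u_entry perm_less)
  have "fl_diff fl ?Au (fl_smult fl (b (i + 1)) ?prev) $ \<pi> k
      = fl (s k * sym_tridiag_mat n a b $$ (k, i) - fl (b (i + 1) * ?prev $ \<pi> k))"
    using dims k assms by (simp add: fl_diff_def fl_smult_def perm_less fl_mat_vec_u del: if_distrib)
  also have "\<dots> = ?w $ \<pi> k"
    unfolding prev using k assms a_F[of i] b_F[of i] b_Suc_F[of i]
    by (auto simp: tridiag_entry dim_u perm_less u_entry mult.commute)
  finally show "fl_diff fl ?Au (fl_smult fl (b (i + 1)) ?prev) $ \<pi> k = ?w $ \<pi> k" .
qed

lemma pass_alpha:
  assumes "i < n"
  shows "fl_dot fl sm (a (i + 1) \<cdot>\<^sub>v u i + b (i + 2) \<cdot>\<^sub>v u (i + 1)) (u i) = a (i + 1)"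
    (is "fl_dot fl sm ?w _ = _")
proof -
  have prod: "?w $ \<pi> i * u i $ \<pi> i = a (i + 1)"
    using assms sign[of i] by (auto simp: dim_u perm_less u_entry)
  have "fl_dot fl sm ?w (u i) = fl (?w $ \<pi> i * u i $ \<pi> i)"
  proof (rule fl_dot_single_nonzero)
    show "?w $ j * u i $ j = 0" if "j < n" "j \<noteq> \<pi> i" for j
      using that by (simp add: signed_unit_vec_def)
  qed (use assms prod a_F[of i] in \<open>auto simp: dim_u perm_less\<close>)
  with prod a_F[OF assms] show ?thesis by simp
qed

lemma pass_z:
  assumes "i < n"
  shows "fl_diff fl (a (i + 1) \<cdot>\<^sub>v u i + b (i + 2) \<cdot>\<^sub>v u (i + 1)) (fl_smult fl (a (i + 1)) (u i))
    = b (i + 2) \<cdot>\<^sub>v u (i + 1)"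
proof (rule eq_vec_permI)
  fix k assume k: "k < n"
  then show "fl_diff fl (a (i + 1) \<cdot>\<^sub>v u i + b (i + 2) \<cdot>\<^sub>v u (i + 1)) (fl_smult fl (a (i + 1)) (u i)) $ \<pi> k
    = (b (i + 2) \<cdot>\<^sub>v u (i + 1)) $ \<pi> k"
    using assms a_F[of i] b_Suc_F[of i]
    by (auto simp: fl_diff_def fl_smult_def dim_u perm_less u_entry)
qed (auto simp: fl_diff_def fl_smult_def dim_u)

lemma norm_multiple_u:
  assumes "j < n" "norm_recovers c"
  shows "fl_norm fl sm (c \<cdot>\<^sub>v u j) = c"
proof (rule fl_norm_single_nonzero)
  show "\<bar>(c \<cdot>\<^sub>v u j) $ \<pi> j\<bar> = \<bar>c\<bar>"
    using assms sign[of j] by (auto simp: dim_u perm_less u_entry)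
  show "(c \<cdot>\<^sub>v u j) $ i = 0" if "i < n" "i \<noteq> \<pi> j" for i
    using that by (simp add: signed_unit_vec_def)
qed (use assms in \<open>auto simp: dim_u perm_less\<close>)

lemma divide_multiple_u:
  assumes "j < n" "c \<noteq> 0"
  shows "fl_div fl (c \<cdot>\<^sub>v u j) c = u j"
  using assms by (intro eq_vec_permI) (auto simp: fl_div_def dim_u perm_less u_entry)

lemma pass_beta:
  assumes "i < n"
  shows "fl_norm fl sm (b (i + 2) \<cdot>\<^sub>v u (i + 1)) = b (i + 2)"
proof (cases "i + 1 < n")
  case True
  then show ?thesis using norm_multiple_u b_Suc_recovers assms by blast
next
  case False
  with assms have "b (i + 2) = 0" using b_end by (auto dest: Suc_lessI)
  moreover have "0 \<cdot>\<^sub>v u (i + 1) = 0 \<cdot>\<^sub>v u i" by (auto simp: dim_u)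
  ultimately show ?thesis using norm_multiple_u[OF assms norm_recovers_zero] by simp
qed

lemma lanczos_loop_run:
  assumes "i \<le> n"
  shows "lanczos_loop fl sm A (n - i) (if i = 0 then 0\<^sub>v n else u (i - 1)) (u i) (b (i + 1))
    = map (tridiagonal_pass n \<pi> s a b) [i..<n]"
  using assms
proof (induction "n - i" arbitrary: i)
  case 0
  then show ?case by simp
next
  case (Suc k)
  then have i: "i < n" and k: "n - (i + 1) = k" by auto
  show ?case
  proof (cases "i + 1 < n")
    case True
    have "lanczos_loop fl sm A k (u i) (u (i + 1)) (b (i + 2))
        = map (tridiagonal_pass n \<pi> s a b) [i + 1..<n]"
      using Suc.hyps(1)[of "i + 1"] k True by simp
    then show ?thesis
      using True i b_nonzero[OF True]
      by (simp add: Suc.hyps(2)[symmetric] Let_def pass_w[simplified] pass_alpha[simplified]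
          pass_z[simplified] pass_beta[simplified]
          divide_multiple_u[of "Suc i"] upt_conv_Cons tridiagonal_pass_def)
  next
    case False
    with i have n: "n = Suc i" by simp
    have "b (Suc (Suc i)) = 0" using b_end n by simp
    then show ?thesis
      using i pass_w[OF i] pass_alpha[OF i] pass_z[OF i] pass_beta[OF i] n
      by (simp add: Suc.hyps(2)[symmetric] Let_def tridiagonal_pass_def)
  qed
qed

lemma lanczos_run:
  assumes "0 < n"
  shows "lanczos fl sm A (b 1 \<cdot>\<^sub>v u 0)
    = \<lparr>run_beta1 = b 1, run_v1 = u 0, run_passes = map (tridiagonal_pass n \<pi> s a b) [0..<n]\<rparr>"
proof -
  have "fl_norm fl sm (b 1 \<cdot>\<^sub>v u 0) = b 1"
    using norm_multiple_u[OF assms] b_recovers[OF assms] by simp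
  moreover have "fl_div fl (b 1 \<cdot>\<^sub>v u 0) (b 1) = u 0"
    using divide_multiple_u[OF assms] b_nonzero[OF assms] by simp
  moreover have "dim_row A = n" using A_carrier by simp
  ultimately show ?thesis
    using lanczos_loop_run[of 0] by (simp add: lanczos_def Let_def)
qed

end


lemma signed_permutation_mat_unit_vec:
  assumes "j < n"
  shows "mat n n (\<lambda>(i, j). if i = \<pi> j then s j else 0) *\<^sub>v unit_vec n j = signed_unit_vec n \<pi> s j"
  using assms by (intro eq_vecI) (auto simp: signed_unit_vec_def scalar_prod_right_unit)

lemma signed_permutation_conjugate_entry:
  fixes T P :: "'a :: comm_semiring_1 mat" and s :: "nat \<Rightarrow> 'a"
  assumes \<pi>: "\<pi> permutes {..<n}" and T: "T \<in> carrier_mat n n"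
    and P: "P = mat n n (\<lambda>(i, j). if i = \<pi> j then s j else 0)"
    and ij: "i < n" "j < n"
  shows "(P * T * transpose_mat P) $$ (\<pi> i, \<pi> j) = s i * s j * T $$ (i, j)"
proof -
  have less: "\<pi> k < n \<longleftrightarrow> k < n" for k
    using permutes_in_image[OF \<pi>, of k] by simp
  have P_entry: "P $$ (\<pi> k, l) = (if l = k then s k else 0)" if "k < n" "l < n" for k l
    using that permutes_inj[OF \<pi>] by (auto simp: P less dest: injD)
  have PT: "(P * T) $$ (\<pi> i, l) = s i * T $$ (i, l)" if "l < n" for l
  proof -
    have "(P * T) $$ (\<pi> i, l) = (\<Sum>m = 0..<n. P $$ (\<pi> i, m) * T $$ (m, l))"
      using T that ij by (auto simp: scalar_prod_def P less)
    also have "\<dots> = (\<Sum>m = 0..<n. if m = i then s i * T $$ (i, l) else 0)"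
      using ij by (intro sum.cong) (auto simp: P_entry)
    finally show ?thesis using ij by simp
  qed
  have "(P * T * transpose_mat P) $$ (\<pi> i, \<pi> j) = (\<Sum>l = 0..<n. (P * T) $$ (\<pi> i, l) * P $$ (\<pi> j, l))"
    using T ij by (auto simp: scalar_prod_def P less)
  also have "\<dots> = (\<Sum>l = 0..<n. if l = j then s i * T $$ (i, j) * s j else 0)"
    using ij by (intro sum.cong) (auto simp: P_entry PT)
  finally show ?thesis using ij by (simp add: ac_simps)
qed

theorem theorem4p2:
  fixes p emax n :: nat
    and fl :: "real \<Rightarrow> real" and sm :: "real list \<Rightarrow> real"
    and a b :: "nat \<Rightarrow> real"
    and A P T :: "real mat" and v :: "real vec"
  assumes "2 \<le> p" and "1 \<le> emax"
    and "rounds_to_nearest p emax fl"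
    and "summation_scheme fl sm"
    and "1 \<le> n"
    and "signed_permutation_mat n P" and "elements_mat P \<subseteq> fp_numbers p emax"
    and "T = sym_tridiag_mat n a b" and "elements_mat T \<subseteq> fp_numbers p emax"
    and "b 1 \<in> fp_numbers p emax"
    and "\<forall>j\<in>{1..n}. b j > 0 \<and> within_exponent_range p emax ((b j)\<^sup>2)"
    and "A = P * T * transpose_mat P"
    and "v = b 1 \<cdot>\<^sub>v (P *\<^sub>v unit_vec n 0)"
  shows "lanczos_computes_exactly fl sm A v
    \<and> length (run_passes (lanczos fl sm A v)) = n
    \<and> lanczos_T n (lanczos fl sm A v) = T"
proof -
  let ?F = "fp_numbers p emax"
  have p: "1 \<le> p" using assms(1) by simp
  obtain \<pi> s where \<pi>: "\<pi> permutes {..<n}" and s: "\<And>j. j < n \<Longrightarrow> s j = 1 \<or> s j = - 1"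
    and P: "P = mat n n (\<lambda>(i, j). if i = \<pi> j then s j else 0)"
    using assms(6) unfolding signed_permutation_mat_def by blast
  \<comment> \<open>Zero is the norm that stops the run in pass \<open>n\<close>; the matrix \<open>T\<close> stays the same.\<close>
  define b0 where "b0 = b(n + 1 := 0)"
  have T: "T = sym_tridiag_mat n a b0"
    unfolding assms(8) sym_tridiag_mat_def b0_def by (intro eq_matI) auto
  have T_carrier: "T \<in> carrier_mat n n" by (simp add: T sym_tridiag_mat_def)
  have T_F: "T $$ (i, j) \<in> ?F" if "i < n" "j < n" for i j
    using assms(9) T_carrier that by (fastforce simp: elements_mat_def)
  have A_carrier: "A \<in> carrier_mat n n"
    unfolding assms(12) P using T_carrier
    by (intro mult_carrier_mat[of _ n n]) (auto intro: mult_carrier_mat)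
  have A_entry: "A $$ (\<pi> i, \<pi> j) = s i * s j * sym_tridiag_mat n a b0 $$ (i, j)"
    if "i < n" "j < n" for i j
    using signed_permutation_conjugate_entry[OF \<pi> T_carrier P that] by (simp add: assms(12) T)
  have a_F: "a (i + 1) \<in> ?F" if "i < n" for i
    using T_F[OF that that] that by (simp add: T sym_tridiag_mat_def)
  have b_F: "b (i + 1) \<in> ?F" if "i < n" for i
  proof (cases i)
    case 0
    then show ?thesis using assms(10) by simp
  next
    case (Suc k)
    then show ?thesis using T_F[of k i] that by (simp add: assms(8) sym_tridiag_mat_def)
  qed
  have b_pos: "b (i + 1) > 0" and b_nonzero: "b (i + 1) \<noteq> 0"
    and b_range: "within_exponent_range p emax ((b (i + 1))\<^sup>2)"
    if "i < n" for i
    using bspec[OF assms(11), of "i + 1"] that by auto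
  interpret fp: single_term_arithmetic fl sm ?F
    using p assms(2-4) by (rule fp_single_term_arithmetic)
  interpret ex: single_term_arithmetic "\<lambda>x. x" sum_list UNIV
    by (rule exact_single_term_arithmetic)
  have fp_recovers: "fp.norm_recovers (b (i + 1))" if "i < n" for i
    unfolding fp.norm_recovers_def
    using rounds_to_nearest_in_fp_numbers[OF assms(3) b_range[OF that]]
      rounded_sqrt_of_rounded_square[OF p assms(2,3) b_F[OF that] b_pos[OF that] b_range[OF that]]
    by simp
  have ex_recovers: "ex.norm_recovers (b (i + 1))" if "i < n" for i
    unfolding ex.norm_recovers_def using b_pos[OF that] by simp
  interpret fp: signed_permuted_tridiagonal fl sm ?F n \<pi> s a b0 A
    using \<pi> s A_carrier A_entry a_F b_F b_nonzero fp_recovers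
    by unfold_locales (auto simp: b0_def)
  interpret ex: signed_permuted_tridiagonal "\<lambda>x. x" sum_list UNIV n \<pi> s a b0 A
    using \<pi> s A_carrier A_entry b_nonzero ex_recovers
    by unfold_locales (auto simp: b0_def)
  have n: "0 < n" using assms(5) by simp
  have v: "v = b0 1 \<cdot>\<^sub>v signed_unit_vec n \<pi> s 0"
    using n by (simp add: assms(13) P signed_permutation_mat_unit_vec b0_def)
  have "lanczos_computes_exactly fl sm A v"
    unfolding lanczos_computes_exactly_def exact_lanczos_def v fp.lanczos_run[OF n] ex.lanczos_run[OF n] ..
  moreover have "lanczos_T n (lanczos fl sm A v) = T"
    unfolding v fp.lanczos_run[OF n] T lanczos_T_def sym_tridiag_mat_def
    by (intro eq_matI) (auto simp: run_alpha_def run_beta_def tridiagonal_pass_def)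
  moreover have "length (run_passes (lanczos fl sm A v)) = n"
    unfolding v fp.lanczos_run[OF n] by simp
  ultimately show ?thesis by blast
qed

end
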